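(* Let $M,I_1,\dots,I_M,d$ be positive integers with $d\le I_1\cdots I_M$. Let $\mathcal{A},\mathcal{B},\mathcal{C}\in\mathbb{R}^{I_1\times\cdots\times I_M\times I_1\times\cdots\times I_M}$ be symmetric tensors such that $\mathcal{C}$ is positive definite, $\mathcal{B}$ is positive semi-definite, and $\dim\mathcal{N}(\mathcal{B})<d$. Then the Trace Ratio problem $$\max_{\substack{\mathcal{P}\in\mathbb{R}^{I_1\times\cdots\times I_M\times d}\\ \mathcal{P}^T*_M\mathcal{C}*_M\mathcal{P}=I_d}}\ \frac{\operatorname{Tr}\left(\mathcal{P}^T*_M\mathcal{A}*_M\mathcal{P}\right)}{\operatorname{Tr}\left(\mathcal{P}^T*_M\mathcal{B}*_M\mathcal{P}\right)}$$ has a finite maximum value; likewise, the corresponding minimization problem has a finite minimum value.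
   Context: The Einstein product $*_N$ of two tensors contracts the last $N$ modes of the first with the first $N$ modes of the second: $(\mathcal{A}*_N\mathcal{Z})_{i_1\ldots j_1\ldots}=\sum_{k_1,\ldots,k_N}\mathcal{A}_{i_1\ldots k_1\ldots k_N}\mathcal{Z}_{k_1\ldots k_N j_1\ldots}$. For $\mathcal{P}\in\mathbb{R}^{I_1\times\cdots\times I_M\times d}$, the transpose $\mathcal{P}^T\in\mathbb{R}^{d\times I_1\times\cdots\times I_M}$ is $(\mathcal{P}^T)_{j i_1\ldots i_M}=\mathcal{P}_{i_1\ldots i_M j}$; hence $\mathcal{P}^T*_M\mathcal{A}*_M\mathcal{P}$ is a $d\times d$ matrix and $\operatorname{Tr}$ is the matrix trace. For $\mathcal{A}\in\mathbb{R}^{I_1\times\cdots\times I_M\times I_1\times\cdots\times I_M}$, $(\mathcal{A}^T)_{j_1\ldots j_M i_1\ldots i_M}=\mathcal{A}_{i_1\ldots i_M j_1\ldots j_M}$, and $\mathcal{A}$ is symmetric if $\mathcal{A}^T=\mathcal{A}$. Such a tensor is positive semi-definite if $\langle\mathcal{X},\mathcal{A}*_M\mathcal{X}\rangle\ge 0$ for all $\mathcal{X}\in\mathbb{R}^{I_1\times\cdots\times I_M}$, and positive definite if the inequality is strict for $\mathcal{X}\ne 0$, where $\langle\cdot,\cdot\rangle$ is the entrywise (Frobenius) inner product. The null space is $\mathcal{N}(\mathcal{B})=\{\mathcal{X}\in\mathbb{R}^{I_1\times\cdots\times I_M}:\mathcal{B}*_M\mathcal{X}=0\}$. *)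

theory Defs
  imports "HOL-Analysis.Analysis" "HOL-Library.Function_Algebras"
begin

text \<open>
  A tensor in \<open>\<real>\<^bsup>I\<^sub>1 \<times> \<dots> \<times> I\<^sub>M\<^esup>\<close> is a real function on multi-indices that vanishes outside the
  (0-based) index range given by the dimension list \<open>[I\<^sub>1, \<dots>, I\<^sub>M]\<close>. Vanishing outside the range makes
  equality of tensors the equality of functions and makes each \<open>tensors ds\<close> a linear subspace of
  dimension \<open>prod_list ds\<close>.
\<close>

type_synonym tensor = "nat list \<Rightarrow> real"

definition indices :: "nat list \<Rightarrow> nat list set" where
  "indices ds = {is. list_all2 (<) is ds}"

definition tensors :: "nat list \<Rightarrow> tensor set" where
  "tensors ds = {X. \<forall>is. is \<notin> indices ds \<longrightarrow> X is = 0}"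

definition tensor_scale :: "real \<Rightarrow> tensor \<Rightarrow> tensor" where
  "tensor_scale c X = (\<lambda>is. c * X is)"

interpretation tensor: vector_space tensor_scale
  by unfold_locales (auto simp: tensor_scale_def fun_eq_iff algebra_simps)

text \<open>
  Einstein product of a tensor of dimensions \<open>ds @ ks\<close> with one of dimensions \<open>ks @ es\<close>, contracting
  the \<open>length ks\<close> shared modes; the result has dimensions \<open>ds @ es\<close>.
\<close>

definition einstein :: "nat list \<Rightarrow> nat list \<Rightarrow> nat list \<Rightarrow> tensor \<Rightarrow> tensor \<Rightarrow> tensor" where
  "einstein ds ks es X Y = (\<lambda>is. if is \<in> indices (ds @ es)
     then \<Sum>k\<in>indices ks. X (take (length ds) is @ k) * Y (k @ drop (length ds) is) else 0)"

text \<open>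
  Block transpose of a tensor of dimensions \<open>ds @ es\<close>; the result has dimensions \<open>es @ ds\<close>.
  The case \<open>es = [d]\<close> gives \<open>P\<^sup>T\<close>, the case \<open>es = ds\<close> the transpose of a square tensor.
\<close>

definition tensor_transpose :: "nat list \<Rightarrow> nat list \<Rightarrow> tensor \<Rightarrow> tensor" where
  "tensor_transpose ds es X = (\<lambda>is. if is \<in> indices (es @ ds)
     then X (drop (length es) is @ take (length es) is) else 0)"

definition tensor_inner :: "nat list \<Rightarrow> tensor \<Rightarrow> tensor \<Rightarrow> real" where
  "tensor_inner ds X Y = (\<Sum>i\<in>indices ds. X i * Y i)"

text \<open>Matrices are tensors of order two.\<close>

definition id_matrix :: "nat \<Rightarrow> tensor" where
  "id_matrix d = (\<lambda>is. if \<exists>j<d. is = [j, j] then 1 else 0)"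

definition matrix_trace :: "nat \<Rightarrow> tensor \<Rightarrow> real" where
  "matrix_trace d X = (\<Sum>j<d. X [j, j])"

definition symmetric_tensor :: "nat list \<Rightarrow> tensor \<Rightarrow> bool" where
  "symmetric_tensor ds A \<longleftrightarrow> tensor_transpose ds ds A = A"

definition pos_semidef_tensor :: "nat list \<Rightarrow> tensor \<Rightarrow> bool" where
  "pos_semidef_tensor ds A \<longleftrightarrow>
     (\<forall>X\<in>tensors ds. tensor_inner ds X (einstein ds ds [] A X) \<ge> 0)"

definition pos_def_tensor :: "nat list \<Rightarrow> tensor \<Rightarrow> bool" where
  "pos_def_tensor ds A \<longleftrightarrow>
     (\<forall>X\<in>tensors ds. X \<noteq> 0 \<longrightarrow> tensor_inner ds X (einstein ds ds [] A X) > 0)"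

definition null_space :: "nat list \<Rightarrow> tensor \<Rightarrow> tensor set" where
  "null_space ds B = {X \<in> tensors ds. einstein ds ds [] B X = 0}"

text \<open>The \<open>d \<times> d\<close> matrix \<open>P\<^sup>T *\<^sub>M A *\<^sub>M P\<close>.\<close>

definition compression :: "nat list \<Rightarrow> nat \<Rightarrow> tensor \<Rightarrow> tensor \<Rightarrow> tensor" where
  "compression ds d A P =
     einstein [d] ds [d] (einstein [d] ds ds (tensor_transpose ds [d] P) A) P"

definition feasible :: "nat list \<Rightarrow> nat \<Rightarrow> tensor \<Rightarrow> tensor set" where
  "feasible ds d C = {P \<in> tensors (ds @ [d]). compression ds d C P = id_matrix d}"

definition trace_ratio :: "nat list \<Rightarrow> nat \<Rightarrow> tensor \<Rightarrow> tensor \<Rightarrow> tensor \<Rightarrow> real" where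
  "trace_ratio ds d A B P =
     matrix_trace d (compression ds d A P) / matrix_trace d (compression ds d B P)"

lemma einstein_append:
  assumes "i \<in> indices ds" "j \<in> indices es"
  shows "einstein ds ks es X Y (i @ j) = (\<Sum>k\<in>indices ks. X (i @ k) * Y (k @ j))"
  using assms by (auto simp: einstein_def indices_def list_all2_appendI dest: list_all2_lengthD)

lemma tensor_transpose_append:
  assumes "i \<in> indices ds" "j \<in> indices es"
  shows "tensor_transpose ds es X (j @ i) = X (i @ j)"
  using assms by (auto simp: tensor_transpose_def indices_def list_all2_appendI dest: list_all2_lengthD)

lemma einstein_in_tensors: "einstein ds ks es X Y \<in> tensors (ds @ es)"
  by (simp add: einstein_def tensors_def)

lemma tensor_transpose_in_tensors: "tensor_transpose ds es X \<in> tensors (es @ ds)"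
  by (simp add: tensor_transpose_def tensors_def)

lemma id_matrix_in_tensors: "id_matrix d \<in> tensors [d, d]"
  by (auto simp: id_matrix_def tensors_def indices_def)

end

theory Submission imports Defs begin

text \<open>
  Write \<open>P\<close> as a family of \<open>d\<close> columns \<open>p\<^sub>1, \<dots>, p\<^sub>d\<close>, each a tensor of dimensions \<open>ds\<close>. The entries of
  \<open>P\<^sup>T *\<^sub>M A *\<^sub>M P\<close> are the values \<open>\<langle>p\<^sub>j, A *\<^sub>M p\<^sub>l\<rangle>\<close> of a bilinear form (\<open>compression_entry\<close>), so \<open>P\<close> is
  feasible exactly if its columns are orthonormal for the inner product given by \<open>C\<close>
  (\<open>feasible_iff\<close>). The claim is then Weierstrass' extreme value theorem for the trace ratio, and
  three things have to be checked.

  The feasible set is compact (\<open>compact_feasible\<close>). It is closed because its defining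
  equations are continuous in the entries. It is bounded because \<open>C\<close>, being positive on
  the compact unit sphere, satisfies \<open>\<langle>X, C *\<^sub>M X\<rangle> \<ge> c \<parallel>X\<parallel>\<^sup>2\<close> with a constant \<open>c > 0\<close>
  (\<open>pos_def_coercive\<close>), whence every column of a feasible \<open>P\<close> has norm at most \<open>c\<^sup>-\<^sup>1\<^sup>/\<^sup>2\<close>. The
  topology is that of pointwise convergence on all functions from multi-indices to reals;
  compactness of boxes is Tychonoff's theorem.

  The feasible set is nonempty (\<open>feasible_nonempty\<close>), by Gram-Schmidt with respect to \<open>C\<close> in a
  space of dimension \<open>I\<^sub>1 \<cdots> I\<^sub>M \<ge> d\<close>.

  The denominator is positive on it (\<open>trace_compression_pos\<close>). It is a sum of the nonnegative
  terms \<open>\<langle>p\<^sub>j, B *\<^sub>M p\<^sub>j\<rangle>\<close>; if it vanished, every \<open>p\<^sub>j\<close> would be isotropic for \<open>B\<close> and hence lie in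
  its null space (\<open>psd_isotropic_in_null_space\<close>), which would then contain \<open>d\<close> linearly
  independent elements and have dimension at least \<open>d\<close>.
\<close>

section \<open>Multi-indices\<close>
lemma indices_Nil: "indices [] = {[]}"
  by (auto simp: indices_def)

lemma indices_Cons: "indices (n # ds) = (\<lambda>(j, i). j # i) ` ({..<n} \<times> indices ds)"
  by (auto simp: indices_def list_all2_Cons2 image_iff)

lemma finite_indices [simp]: "finite (indices ds)"
  by (induction ds) (auto simp: indices_Nil indices_Cons)

lemma card_indices: "card (indices ds) = prod_list ds"
proof (induction ds)
  case (Cons n ds)
  have "inj_on (\<lambda>(j, i). j # i) ({..<n} \<times> indices ds)"
    by (auto simp: inj_on_def)
  then show ?case
    using Cons by (simp add: indices_Cons card_image card_cartesian_product)
qed (simp add: indices_Nil)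

lemma snoc_in_indices_iff: "i @ [j] \<in> indices (ds @ [d]) \<longleftrightarrow> i \<in> indices ds \<and> j < d"
  unfolding indices_def mem_Collect_eq by (subst list_all2_rev[symmetric]) auto

lemma indices_snocE:
  assumes "is \<in> indices (ds @ [d])"
  obtains i j where "is = i @ [j]" "i \<in> indices ds" "j < d"
proof -
  from assms obtain i v where "is = i @ v" "list_all2 (<) i ds" "list_all2 (<) v [d]"
    unfolding indices_def mem_Collect_eq list_all2_append2 by blast
  moreover from this(3) obtain j where "v = [j]" "j < d"
    by (auto simp: list_all2_Cons2)
  ultimately show thesis
    using that by (simp add: indices_def)
qed

section \<open>Bilinear forms and columns\<close>
definition bilin :: "nat list \<Rightarrow> tensor \<Rightarrow> tensor \<Rightarrow> tensor \<Rightarrow> real" where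
  "bilin ds A X Y = (\<Sum>i\<in>indices ds. \<Sum>k\<in>indices ds. X i * A (i @ k) * Y k)"

definition column :: "tensor \<Rightarrow> nat \<Rightarrow> tensor" where
  "column P j = (\<lambda>i. P (i @ [j]))"

lemma column_in_tensors: "P \<in> tensors (ds @ [d]) \<Longrightarrow> column P j \<in> tensors ds"
  by (auto simp: tensors_def column_def snoc_in_indices_iff)

lemma compression_entry:
  assumes "j < d" "l < d"
  shows "compression ds d A P [j, l] = bilin ds A (column P j) (column P l)"
proof -
  have jl: "[j] \<in> indices [d]" "[l] \<in> indices [d]"
    using assms by (auto simp: indices_def)
  have "compression ds d A P ([j] @ [l]) =
      (\<Sum>k\<in>indices ds. (\<Sum>i\<in>indices ds. P (i @ [j]) * A (i @ k)) * P (k @ [l]))"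
    unfolding compression_def einstein_append[OF jl]
    by (intro sum.cong refl, subst einstein_append[OF jl(1)], assumption)
       (simp add: tensor_transpose_append jl del: append_Cons)
  also have "\<dots> = bilin ds A (column P j) (column P l)"
    unfolding bilin_def column_def by (subst sum.swap) (simp add: sum_distrib_right)
  finally show ?thesis by simp
qed

lemma matrix_trace_compression:
  "matrix_trace d (compression ds d A P) = (\<Sum>j<d. bilin ds A (column P j) (column P j))"
  by (simp add: matrix_trace_def compression_entry)

text \<open>
  Both sides of the constraint \<open>P\<^sup>T *\<^sub>M C *\<^sub>M P = I\<^sub>d\<close> vanish outside the \<open>d \<times> d\<close> range, so this equation
  between functions reduces to finitely many scalar equations, which are visibly closed conditions.
\<close>
lemma feasible_iff:
  "P \<in> feasible ds d C \<longleftrightarrow> P \<in> tensors (ds @ [d]) \<and>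
    (\<forall>j<d. \<forall>l<d. bilin ds C (column P j) (column P l) = (if j = l then 1 else 0))"
proof -
  have "compression ds d C P = id_matrix d \<longleftrightarrow>
      (\<forall>j<d. \<forall>l<d. compression ds d C P [j, l] = (if j = l then 1 else 0))"
  proof
    assume R: "\<forall>j<d. \<forall>l<d. compression ds d C P [j, l] = (if j = l then 1 else 0)"
    show "compression ds d C P = id_matrix d"
    proof
      fix ls
      show "compression ds d C P ls = id_matrix d ls"
      proof (cases "ls \<in> indices [d, d]")
        case True
        then obtain j l where "ls = [j, l]" "j < d" "l < d"
          by (auto simp: indices_def list_all2_Cons2)
        then show ?thesis
          using R by (auto simp: id_matrix_def)
      next
        case False
        moreover have "compression ds d C P \<in> tensors ([d] @ [d])"
          unfolding compression_def by (rule einstein_in_tensors)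
        ultimately show ?thesis
          using id_matrix_in_tensors[of d] by (simp add: tensors_def)
      qed
    qed
  qed (auto simp: id_matrix_def)
  then show ?thesis
    by (auto simp: feasible_def compression_entry)
qed

lemma bilin_add_left: "bilin ds A (X + Y) Z = bilin ds A X Z + bilin ds A Y Z"
  by (simp add: bilin_def algebra_simps sum.distrib)

lemma bilin_add_right: "bilin ds A Z (X + Y) = bilin ds A Z X + bilin ds A Z Y"
  by (simp add: bilin_def algebra_simps sum.distrib)

lemma bilin_scale_left: "bilin ds A (tensor_scale c X) Z = c * bilin ds A X Z"
  by (simp add: bilin_def tensor_scale_def sum_distrib_left mult.assoc)

lemma bilin_scale_right: "bilin ds A Z (tensor_scale c X) = c * bilin ds A Z X"
  by (simp add: bilin_def tensor_scale_def sum_distrib_left mult_ac)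

lemma bilin_diff_right: "bilin ds A Z (X - Y) = bilin ds A Z X - bilin ds A Z Y"
  by (simp add: bilin_def algebra_simps sum_subtractf)

lemma bilin_zero_right: "bilin ds A Z 0 = 0"
  by (simp add: bilin_def)

lemma bilin_sum_right:
  "bilin ds A Z (\<Sum>x\<in>S. f x) = (\<Sum>x\<in>S. bilin ds A Z (f x))"
  by (induction S rule: infinite_finite_induct)
     (simp_all only: sum.infinite sum.empty sum.insert bilin_zero_right bilin_add_right not_False_eq_True)

lemma bilin_commute:
  assumes "symmetric_tensor ds A"
  shows "bilin ds A X Y = bilin ds A Y X"
proof -
  have "A (k @ i) = A (i @ k)" if "i \<in> indices ds" "k \<in> indices ds" for i k
    using tensor_transpose_append[OF that, of A] assms by (simp add: symmetric_tensor_def)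
  then show ?thesis
    unfolding bilin_def by (subst sum.swap) (simp add: mult_ac)
qed

lemma einstein_apply:
  assumes "i \<in> indices ds"
  shows "einstein ds ds [] A X i = (\<Sum>k\<in>indices ds. A (i @ k) * X k)"
  using einstein_append[OF assms, of "[]" "[]"] by (simp add: indices_Nil)

lemma tensor_inner_einstein: "tensor_inner ds X (einstein ds ds [] A Y) = bilin ds A X Y"
  by (simp add: tensor_inner_def bilin_def einstein_apply sum_distrib_left mult.assoc)

section \<open>Dimension of tensor spaces\<close>
lemma subspace_tensors: "tensor.subspace (tensors ds)"
  by (auto simp: tensor.subspace_def tensors_def tensor_scale_def)

definition unit_tensor :: "nat list \<Rightarrow> tensor" where
  "unit_tensor i = (\<lambda>k. if k = i then 1 else 0)"

lemma inj_unit_tensor: "inj unit_tensor"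
proof (rule injI)
  fix i j assume "unit_tensor i = unit_tensor j"
  then have "unit_tensor i i = unit_tensor j i" by simp
  then show "i = j" by (simp add: unit_tensor_def split: if_splits)
qed

lemma unit_tensor_in_tensors: "i \<in> indices ds \<Longrightarrow> unit_tensor i \<in> tensors ds"
  by (auto simp: tensors_def unit_tensor_def)

lemma sum_apply: "(\<Sum>x\<in>S. f x) k = (\<Sum>x\<in>S. f x k)" for f :: "'b \<Rightarrow> 'c \<Rightarrow> real"
  by (induction S rule: infinite_finite_induct) simp_all

lemma independent_unit_tensors: "tensor.independent (unit_tensor ` indices ds)"
proof (rule tensor.independent_if_scalars_zero)
  fix f x
  assume eq: "(\<Sum>x\<in>unit_tensor ` indices ds. tensor_scale (f x) x) = 0"
    and "x \<in> unit_tensor ` indices ds"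
  then obtain i where i: "x = unit_tensor i" "i \<in> indices ds" by auto
  have "0 = (\<Sum>k\<in>indices ds. tensor_scale (f (unit_tensor k)) (unit_tensor k)) i"
    using eq by (simp add: sum.reindex inj_on_subset[OF inj_unit_tensor])
  also have "\<dots> = (\<Sum>k\<in>indices ds. if k = i then f (unit_tensor k) else 0)"
    unfolding sum_apply by (rule sum.cong) (auto simp: tensor_scale_def unit_tensor_def)
  also have "\<dots> = f x" using i by simp
  finally show "f x = 0" by simp
qed simp

lemma tensors_subset_span: "tensors ds \<subseteq> tensor.span (unit_tensor ` indices ds)"
proof
  fix X assume X: "X \<in> tensors ds"
  have "X = (\<Sum>k\<in>indices ds. tensor_scale (X k) (unit_tensor k))"
  proof
    fix i
    have "(\<Sum>k\<in>indices ds. tensor_scale (X k) (unit_tensor k)) i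
        = (\<Sum>k\<in>indices ds. if k = i then X k else 0)"
      unfolding sum_apply by (rule sum.cong) (auto simp: tensor_scale_def unit_tensor_def)
    also have "\<dots> = X i" using X by (auto simp: tensors_def)
    finally show "X i = (\<Sum>k\<in>indices ds. tensor_scale (X k) (unit_tensor k)) i" by simp
  qed
  also have "\<dots> \<in> tensor.span (unit_tensor ` indices ds)"
    by (intro tensor.span_sum tensor.span_scale tensor.span_base) auto
  finally show "X \<in> tensor.span (unit_tensor ` indices ds)" .
qed

text \<open>
  The ambient space of all functions is infinite-dimensional, and a subspace with an infinite basis
  has dimension 0 by the convention for cardinalities of infinite sets. Inside \<open>tensors ds\<close>, which is spanned by finitely many unit
  tensors, bases are finite and the usual monotonicity holds.
\<close>
lemma card_le_dim_subset_tensors: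
  assumes "tensor.independent S" "S \<subseteq> V" "V \<subseteq> tensors ds"
  shows "card S \<le> tensor.dim V"
proof -
  obtain T where T: "S \<subseteq> T" "T \<subseteq> V" "tensor.independent T" "V \<subseteq> tensor.span T"
    using tensor.maximal_independent_subset_extend[OF assms(2,1)] by metis
  have "T \<subseteq> tensor.span (unit_tensor ` indices ds)"
    using T(2) assms(3) tensors_subset_span by blast
  from tensor.independent_span_bound[OF _ T(3) this] have "finite T"
    by simp
  moreover have "tensor.dim V = card T"
    by (rule tensor.basis_card_eq_dim[OF T(2,4,3), symmetric])
  ultimately show ?thesis
    by (simp add: card_mono[OF _ T(1)])
qed

section \<open>Compactness of the feasible set\<close>
text \<open>
  The box is a product over all multi-indices of compact sets: \<open>{-K..K}\<close> inside the index range,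
  and \<open>{0}\<close> outside it.
\<close>
lemma bounded_tensors_compact:
  "compact {X \<in> tensors ds. \<forall>i\<in>indices ds. \<bar>X i\<bar> \<le> K}"
proof -
  have "{X \<in> tensors ds. \<forall>i\<in>indices ds. \<bar>X i\<bar> \<le> K}
      = (\<Pi>\<^sub>E i\<in>UNIV. if i \<in> indices ds then {-K..K} else {0})"
    by (auto simp: tensors_def PiE_def Pi_def extensional_def abs_le_iff split: if_splits) 
  moreover have "compactin (product_topology (\<lambda>i. euclidean :: real topology) UNIV)
      (\<Pi>\<^sub>E i\<in>UNIV. if i \<in> indices ds then {-K..K} else {0::real})"
    by (subst compactin_PiE) auto
  ultimately show ?thesis
    by (simp add: euclidean_product_topology flip: compactin_euclidean_iff)
qed

lemma continuous_bilin_column: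
  "continuous_on UNIV (\<lambda>P. bilin ds A (column P j) (column P l))"
  unfolding bilin_def column_def by (intro continuous_intros continuous_on_product_coordinates)

text \<open>
  The form attains a minimum on the unit sphere, which is compact, and this minimum is positive;
  the inequality extends to all tensors by homogeneity.
\<close>
lemma pos_def_coercive:
  assumes "pos_def_tensor ds C"
  obtains c where "c > 0" "\<And>X. X \<in> tensors ds \<Longrightarrow> c * (\<Sum>i\<in>indices ds. (X i)\<^sup>2) \<le> bilin ds C X X"
proof -
  define S where "S = {X \<in> tensors ds. (\<Sum>i\<in>indices ds. (X i)\<^sup>2) = 1}"
  have pos: "bilin ds C X X > 0" if "X \<in> tensors ds" "X \<noteq> 0" for X
    using assms that by (simp add: pos_def_tensor_def tensor_inner_einstein)
  have "\<bar>X i\<bar> \<le> 1" if "X \<in> S" "i \<in> indices ds" for X i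
    using member_le_sum[of i "indices ds" "\<lambda>i. (X i)\<^sup>2"] that
    by (simp add: S_def abs_square_le_1)
  \<comment> \<open>The sphere is a closed subset of a box.\<close>
  then have "S = {X \<in> tensors ds. \<forall>i\<in>indices ds. \<bar>X i\<bar> \<le> 1} \<inter> {X. (\<Sum>i\<in>indices ds. (X i)\<^sup>2) = 1}"
    by (auto simp: S_def)
  moreover have "closed {X :: tensor. (\<Sum>i\<in>indices ds. (X i)\<^sup>2) = 1}"
    by (intro closed_Collect_eq continuous_intros continuous_on_product_coordinates)
  ultimately have "compact S"
    by (simp only: compact_Int_closed bounded_tensors_compact)
  have "continuous_on S (\<lambda>X. bilin ds C X X)"
    unfolding bilin_def
    by (rule continuous_on_subset[of UNIV])
       (intro continuous_intros continuous_on_product_coordinates, simp)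
  have "\<exists>c>0. \<forall>X\<in>S. c \<le> bilin ds C X X"
  \<comment> \<open>Some dimension may be 0; then the sphere is empty and any constant will do.\<close>
  proof (cases "S = {}")
    case True
    then show ?thesis by (auto intro: exI[of _ 1])
  next
    case False
    obtain X0 where X0: "X0 \<in> S" "\<forall>X\<in>S. bilin ds C X0 X0 \<le> bilin ds C X X"
      using continuous_attains_inf[OF \<open>compact S\<close> False \<open>continuous_on S _\<close>] by blast
    from X0(1) have "X0 \<in> tensors ds" "X0 \<noteq> 0" by (auto simp: S_def)
    with X0(2) pos[of X0] show ?thesis by blast
  qed
  then obtain c where c: "c > 0" "\<And>X. X \<in> S \<Longrightarrow> c \<le> bilin ds C X X" by metis
  show thesis
  proof
    fix X assume X: "X \<in> tensors ds"
    define s where "s = (\<Sum>i\<in>indices ds. (X i)\<^sup>2)"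
    show "c * s \<le> bilin ds C X X"
    proof (cases "s = 0")
      case True
      then have "\<forall>i\<in>indices ds. X i = 0"
        by (simp add: s_def sum_nonneg_eq_0_iff)
      then show ?thesis
        using True by (simp add: bilin_def)
    next
      case False
      then have s: "s > 0"
        unfolding s_def by (simp add: sum_nonneg less_le)
      define Y where "Y = tensor_scale (1 / sqrt s) X"
      have "Y \<in> tensors ds"
        using X by (simp add: Y_def tensors_def tensor_scale_def)
      moreover have "(\<Sum>i\<in>indices ds. (Y i)\<^sup>2) = (\<Sum>i\<in>indices ds. (X i)\<^sup>2) / s"
        using s unfolding Y_def tensor_scale_def
        by (simp add: power_divide sum_divide_distrib)
      ultimately have "Y \<in> S"
        using s by (simp add: S_def flip: s_def)
      moreover have "bilin ds C Y Y = bilin ds C X X / s"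
        using s by (simp add: Y_def bilin_scale_left bilin_scale_right)
      ultimately show ?thesis
        using c(2)[of Y] s by (simp add: pos_le_divide_eq)
    qed
  qed (use c in simp)
qed

text \<open>
  Coercivity turns the normalisation \<open>\<langle>p\<^sub>j, C *\<^sub>M p\<^sub>j\<rangle> = 1\<close> of the columns into a bound on the entries.
\<close>
lemma compact_feasible:
  assumes "pos_def_tensor ds C"
  shows "compact (feasible ds d C)"
proof -
  obtain c where c: "c > 0" "\<And>X. X \<in> tensors ds \<Longrightarrow> c * (\<Sum>i\<in>indices ds. (X i)\<^sup>2) \<le> bilin ds C X X"
    using pos_def_coercive[OF assms] by blast
  define box where "box = {P \<in> tensors (ds @ [d]). \<forall>i\<in>indices (ds @ [d]). \<bar>P i\<bar> \<le> sqrt (1 / c)}"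
  have "\<bar>P is\<bar> \<le> sqrt (1 / c)" if P: "P \<in> feasible ds d C" and "is": "is \<in> indices (ds @ [d])" for P "is"
  proof -
    obtain i j where ij: "is = i @ [j]" "i \<in> indices ds" "j < d"
      using "is" by (rule indices_snocE)
    have "c * (P is)\<^sup>2 \<le> c * (\<Sum>i\<in>indices ds. (column P j i)\<^sup>2)"
      using member_le_sum[of i "indices ds" "\<lambda>i. (column P j i)\<^sup>2"] ij c(1)
      by (simp add: column_def)
    also have "\<dots> \<le> bilin ds C (column P j) (column P j)"
      using P by (intro c(2) column_in_tensors[of _ _ d]) (simp add: feasible_iff)
    also have "\<dots> = 1"
      using P ij(3) by (simp add: feasible_iff)
    finally have "(P is)\<^sup>2 \<le> 1 / c"
      using c(1) by (simp add: field_simps)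
    then show ?thesis
      using real_le_rsqrt[of "\<bar>P is\<bar>"] by simp
  qed
  then have "feasible ds d C = box \<inter> (\<Inter>j\<in>{..<d}. \<Inter>l\<in>{..<d}.
      {P. bilin ds C (column P j) (column P l) = (if j = l then 1 else 0)})"
    by (auto simp: feasible_iff box_def)
  moreover have "closed (\<Inter>j\<in>{..<d}. \<Inter>l\<in>{..<d}.
      {P. bilin ds C (column P j) (column P l) = (if j = l then 1 else 0)})"
    by (intro closed_INT ballI closed_Collect_eq continuous_bilin_column continuous_on_const)
  ultimately show ?thesis
    by (simp only: box_def compact_Int_closed bounded_tensors_compact)
qed

section \<open>Orthonormal systems and feasible points\<close>
text \<open>
  Orthonormality is stated for sets of tensors, without indexing the elements, because this makes
  it directly comparable with linear independence and dimension.
\<close>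
definition orthonormal :: "nat list \<Rightarrow> tensor \<Rightarrow> tensor set \<Rightarrow> bool" where
  "orthonormal ds C S \<longleftrightarrow> (\<forall>X\<in>S. \<forall>Y\<in>S. bilin ds C X Y = (if X = Y then 1 else 0))"

lemma orthonormal_independent:
  assumes "finite S" "orthonormal ds C S"
  shows "tensor.independent S"
proof (rule tensor.independent_if_scalars_zero)
  fix f x
  assume eq: "(\<Sum>x\<in>S. tensor_scale (f x) x) = 0" and x: "x \<in> S"
  have "0 = bilin ds C x (\<Sum>y\<in>S. tensor_scale (f y) y)"
    unfolding eq by (rule bilin_zero_right[symmetric])
  also have "\<dots> = (\<Sum>y\<in>S. f y * bilin ds C x y)"
    by (simp only: bilin_sum_right bilin_scale_right)
  also have "\<dots> = (\<Sum>y\<in>S. if y = x then f y else 0)"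
    using assms(2) x by (intro sum.cong) (auto simp: orthonormal_def)
  also have "\<dots> = f x"
    using assms(1) x by simp
  finally show "f x = 0" by simp
qed (fact assms(1))

text \<open>
  The Gram-Schmidt step. An orthonormal set with fewer elements than the dimension does not
  span; subtracting from an element outside the span its \<open>C\<close>-orthogonal projection leaves a nonzero
  tensor orthogonal to the whole set, which positive definiteness allows to be normalised.
\<close>
lemma orthonormal_extend:
  assumes C: "symmetric_tensor ds C" "pos_def_tensor ds C"
    and S: "finite S" "S \<subseteq> tensors ds" "orthonormal ds C S" "card S < prod_list ds"
  obtains X where "X \<in> tensors ds" "X \<notin> S" "orthonormal ds C (insert X S)"
proof -
  have "\<not> tensors ds \<subseteq> tensor.span S"
  proof
    assume "tensors ds \<subseteq> tensor.span S"
    then have "unit_tensor ` indices ds \<subseteq> tensor.span S"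
      using unit_tensor_in_tensors by blast
    then have "card (unit_tensor ` indices ds) \<le> card S"
      using tensor.independent_span_bound[OF S(1) independent_unit_tensors] by blast
    then show False
      using S(4) by (simp add: card_image inj_on_subset[OF inj_unit_tensor] card_indices)
  qed
  then obtain Y where Y: "Y \<in> tensors ds" "Y \<notin> tensor.span S" by blast
  define W where "W = (\<Sum>x\<in>S. tensor_scale (bilin ds C x Y) x)"
  have W_span: "W \<in> tensor.span S"
    unfolding W_def by (intro tensor.span_sum tensor.span_scale tensor.span_base)
  then have "W \<in> tensors ds"
    using tensor.span_minimal[OF S(2) subspace_tensors] by blast
  define Z where "Z = Y - W"
  have Z: "Z \<in> tensors ds"
    unfolding Z_def using tensor.subspace_diff[OF subspace_tensors Y(1) \<open>W \<in> tensors ds\<close>] .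
  have "Z \<noteq> 0"
    using W_span Y(2) unfolding Z_def by (metis eq_iff_diff_eq_0)
  have orth: "bilin ds C x Z = 0" if x: "x \<in> S" for x
  proof -
    have "bilin ds C x W = (\<Sum>y\<in>S. bilin ds C y Y * bilin ds C x y)"
      by (simp only: W_def bilin_sum_right bilin_scale_right)
    also have "\<dots> = (\<Sum>y\<in>S. if y = x then bilin ds C y Y else 0)"
      using S(3) x by (intro sum.cong) (auto simp: orthonormal_def)
    also have "\<dots> = bilin ds C x Y"
      using S(1) x by simp
    finally show ?thesis
      by (simp only: Z_def bilin_diff_right diff_self)
  qed
  define b where "b = bilin ds C Z Z"
  have b: "b > 0"
    using C(2) Z \<open>Z \<noteq> 0\<close> by (simp add: b_def pos_def_tensor_def tensor_inner_einstein)
  define X where "X = tensor_scale (1 / sqrt b) Z"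
  have XX: "bilin ds C X X = 1"
    using b by (simp add: X_def bilin_scale_left bilin_scale_right flip: b_def)
  have X_orth: "bilin ds C x X = 0" "bilin ds C X x = 0" if "x \<in> S" for x
    using orth[OF that] bilin_commute[OF C(1), of x] by (simp_all add: X_def bilin_scale_left bilin_scale_right)
  show thesis
  proof
    show "X \<in> tensors ds"
      unfolding X_def by (rule tensor.subspace_scale[OF subspace_tensors Z])
    show "X \<notin> S"
      using X_orth XX by force
    then show "orthonormal ds C (insert X S)"
      using S(3) XX X_orth by (auto simp: orthonormal_def)
  qed
qed

lemma orthonormal_exists:
  assumes C: "symmetric_tensor ds C" "pos_def_tensor ds C" and "k \<le> prod_list ds"
  shows "\<exists>S. finite S \<and> card S = k \<and> S \<subseteq> tensors ds \<and> orthonormal ds C S"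
  using assms(3)
proof (induction k)
  case 0
  then show ?case by (auto simp: orthonormal_def intro: exI[of _ "{}"])
next
  case (Suc k)
  then obtain S where S: "finite S" "card S = k" "S \<subseteq> tensors ds" "orthonormal ds C S"
    by auto
  have "card S < prod_list ds" using S(2) Suc.prems by simp
  then obtain X where "X \<in> tensors ds" "X \<notin> S" "orthonormal ds C (insert X S)"
    using orthonormal_extend[OF C S(1,3,4)] by blast
  with S show ?case
    by (intro exI[of _ "insert X S"]) simp
qed

lemma feasible_nonempty:
  assumes C: "symmetric_tensor ds C" "pos_def_tensor ds C" and "d \<le> prod_list ds"
  shows "feasible ds d C \<noteq> {}"
proof -
  obtain S where S: "finite S" "card S = d" "S \<subseteq> tensors ds" "orthonormal ds C S"
    using orthonormal_exists[OF assms] by blast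
  then obtain p where p: "bij_betw p {..<d} S"
    using ex_bij_betw_nat_finite[of S] by (auto simp: atLeast0LessThan)
  define P where "P = (\<lambda>is. if is \<in> indices (ds @ [d]) then p (last is) (butlast is) else 0)"
  have pS: "p j \<in> S" if "j < d" for j
    using p that by (auto simp: bij_betw_def)
  have col: "column P j = p j" if "j < d" for j
    using pS[OF that] S(3) that
    by (auto simp: column_def P_def snoc_in_indices_iff tensors_def fun_eq_iff)
  have "P \<in> tensors (ds @ [d])"
    by (simp add: P_def tensors_def)
  moreover have "bilin ds C (p j) (p l) = (if j = l then 1 else 0)" if "j < d" "l < d" for j l
    using S(4) pS that bij_betw_imp_inj_on[OF p] by (auto simp: orthonormal_def inj_on_def)
  ultimately have "P \<in> feasible ds d C"
    by (simp add: feasible_iff col)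
  then show ?thesis by blast
qed

lemma feasible_columns:
  assumes "P \<in> feasible ds d C"
  shows "orthonormal ds C (column P ` {..<d})" "card (column P ` {..<d}) = d"
proof -
  have on: "bilin ds C (column P j) (column P l) = (if j = l then 1 else 0)" if "j < d" "l < d" for j l
    using assms that by (auto simp: feasible_iff)
  have "inj_on (column P) {..<d}"
  proof (rule inj_onI)
    fix j l assume "j \<in> {..<d}" "l \<in> {..<d}" "column P j = column P l"
    then show "j = l"
      using on[of j l] on[of l l] by (auto split: if_splits)
  qed
  then show "card (column P ` {..<d}) = d"
    by (simp add: card_image)
  from \<open>inj_on _ _\<close> show "orthonormal ds C (column P ` {..<d})"
    by (auto simp: orthonormal_def on inj_on_def)
qed

section \<open>Positivity of the denominator\<close>
text \<open>
  The first-order condition at a minimum: with \<open>R = B *\<^sub>M X\<close>, the form of \<open>B\<close> at \<open>X + t R\<close> is the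
  polynomial \<open>2 t \<parallel>R\<parallel>\<^sup>2 + t\<^sup>2 \<langle>R, B *\<^sub>M R\<rangle>\<close>. It is nonnegative and vanishes at \<open>t = 0\<close>, so its slope
  \<open>2 \<parallel>R\<parallel>\<^sup>2\<close> there must be zero.
\<close>
lemma psd_isotropic_in_null_space:
  assumes B: "symmetric_tensor ds B" "pos_semidef_tensor ds B"
    and X: "X \<in> tensors ds" "bilin ds B X X = 0"
  shows "X \<in> null_space ds B"
proof -
  define R where "R = einstein ds ds [] B X"
  have R: "R \<in> tensors ds"
    using einstein_in_tensors[of ds ds "[]"] by (simp add: R_def)
  define r where "r = (\<Sum>i\<in>indices ds. (R i)\<^sup>2)"
  have RX: "bilin ds B R X = r"
    by (simp add: r_def R_def tensor_inner_def power2_eq_square flip: tensor_inner_einstein)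
  define e where "e = bilin ds B R R"
  have e: "e \<ge> 0"
    using B(2) R by (simp add: e_def pos_semidef_tensor_def tensor_inner_einstein)
  have quad: "0 \<le> t * (2 * r + t * e)" for t
  proof -
    have "X + tensor_scale t R \<in> tensors ds"
      by (intro tensor.subspace_add tensor.subspace_scale subspace_tensors X R)
    then have "0 \<le> bilin ds B (X + tensor_scale t R) (X + tensor_scale t R)"
      using B(2) unfolding pos_semidef_tensor_def tensor_inner_einstein by blast
    also have "\<dots> = t * (2 * r + t * e)"
      unfolding bilin_add_left bilin_add_right bilin_scale_left bilin_scale_right
      using bilin_commute[OF B(1), of X R] X(2) RX by (simp add: e_def algebra_simps)
    finally show ?thesis .
  qed
  have r: "r \<ge> 0" unfolding r_def by (simp add: sum_nonneg)
  have "r = 0"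
  proof (rule ccontr)
    assume "r \<noteq> 0"
    with r have "r > 0" by simp
    \<comment> \<open>The minimiser of the quadratic is \<open>- r / e\<close>; the shift by 1 covers \<open>e = 0\<close>.\<close>
    define t where "t = - r / (e + 1)"
    have t: "t < 0" using \<open>r > 0\<close> e by (simp add: t_def)
    have "2 * r + t * e = r + r / (e + 1)"
      using e by (simp add: t_def field_simps)
    also have "\<dots> > 0" using \<open>r > 0\<close> e by (simp add: add_pos_nonneg)
    finally have "t * (2 * r + t * e) < 0"
      using t by (rule mult_neg_pos[rotated])
    with quad[of t] show False by simp
  qed
  then have "\<forall>i\<in>indices ds. R i = 0"
    by (simp add: r_def sum_nonneg_eq_0_iff)
  then have "R = 0"
    using R by (auto simp: tensors_def fun_eq_iff)
  then show ?thesis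
    using X(1) by (simp add: null_space_def R_def)
qed

text \<open>
  Orthonormal columns are independent, so fewer than \<open>d\<close> dimensions of null space cannot contain all
  of them, and at least one of the nonnegative summands of the trace is positive.
\<close>
lemma trace_compression_pos:
  assumes B: "symmetric_tensor ds B" "pos_semidef_tensor ds B"
    and "tensor.dim (null_space ds B) < d" and P: "P \<in> feasible ds d C"
  shows "matrix_trace d (compression ds d B P) > 0"
proof (rule ccontr)
  assume "\<not> ?thesis"
  moreover have cols: "column P j \<in> tensors ds" for j
    using P column_in_tensors by (auto simp: feasible_iff)
  then have nonneg: "bilin ds B (column P j) (column P j) \<ge> 0" for j
    using B(2) by (simp add: pos_semidef_tensor_def tensor_inner_einstein)
  then have "(\<Sum>j<d. bilin ds B (column P j) (column P j)) \<ge> 0"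
    by (rule sum_nonneg)
  ultimately have "(\<Sum>j<d. bilin ds B (column P j) (column P j)) = 0"
    unfolding matrix_trace_compression by linarith
  then have "bilin ds B (column P j) (column P j) = 0" if "j < d" for j
    using that nonneg by (simp add: sum_nonneg_eq_0_iff)
  then have "column P ` {..<d} \<subseteq> null_space ds B"
    using psd_isotropic_in_null_space[OF B cols] by auto
  moreover have "null_space ds B \<subseteq> tensors ds"
    by (auto simp: null_space_def)
  moreover have "tensor.independent (column P ` {..<d})"
    using orthonormal_independent[OF _ feasible_columns(1)[OF P]] by simp
  ultimately have "d \<le> tensor.dim (null_space ds B)"
    using card_le_dim_subset_tensors feasible_columns(2)[OF P] by metis
  with assms(3) show False by simp
qed

section \<open>Existence of extremal trace ratios\<close>
theorem proposition3p2:
  fixes ds :: "nat list" and d :: nat and A B C :: tensor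
  assumes "ds \<noteq> []" and "\<forall>n\<in>set ds. n > 0"
    and "d > 0" and "d \<le> prod_list ds"
    and "A \<in> tensors (ds @ ds)" and "B \<in> tensors (ds @ ds)" and "C \<in> tensors (ds @ ds)"
    and "symmetric_tensor ds A" and "symmetric_tensor ds B" and "symmetric_tensor ds C"
    and "pos_def_tensor ds C" and "pos_semidef_tensor ds B"
    and "tensor.dim (null_space ds B) < d"
  shows "(\<forall>P\<in>feasible ds d C. matrix_trace d (compression ds d B P) \<noteq> 0) \<and>
    (\<exists>P\<in>feasible ds d C. \<forall>Q\<in>feasible ds d C. trace_ratio ds d A B Q \<le> trace_ratio ds d A B P) \<and>
    (\<exists>P\<in>feasible ds d C. \<forall>Q\<in>feasible ds d C. trace_ratio ds d A B P \<le> trace_ratio ds d A B Q)"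
proof -
  have nz: "\<forall>P\<in>feasible ds d C. matrix_trace d (compression ds d B P) \<noteq> 0"
  proof
    fix P assume "P \<in> feasible ds d C"
    then have "matrix_trace d (compression ds d B P) > 0"
      by (rule trace_compression_pos[OF assms(9,12,13)])
    then show "matrix_trace d (compression ds d B P) \<noteq> 0" by linarith
  qed
  have cont: "continuous_on (feasible ds d C) (\<lambda>P. matrix_trace d (compression ds d T P))" for T
    unfolding matrix_trace_compression
    by (intro continuous_on_sum continuous_on_subset[OF continuous_bilin_column] subset_UNIV)
  have cont_ratio: "continuous_on (feasible ds d C) (trace_ratio ds d A B)"
    using continuous_on_divide[OF cont cont nz] by (simp add: trace_ratio_def[abs_def])
  have ne: "compact (feasible ds d C)" "feasible ds d C \<noteq> {}"
    using compact_feasible feasible_nonempty assms(4,10,11) by simp_all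
  show ?thesis
    using nz continuous_attains_sup[OF ne cont_ratio] continuous_attains_inf[OF ne cont_ratio] by simp
qed

end
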